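(* Let $k$ be a field, $V$ a $k$-vector space, and $T \in \mathrm{End}_k(V)$ triangular with respect to some well-ordered basis $(\mathcal{B}, \leq)$ for $V$. Also for each $v \in \mathcal{B}$ let $\pi_v \in \mathrm{End}_k(V)$ be the projection onto $\langle v \rangle$ with kernel $\langle \mathcal{B} \setminus \{v\} \rangle$. Then the following are equivalent. (1) $T$ is invertible. (2) The restriction of $T$ to any finite-dimensional $T$-invariant subspace of $V$ is invertible. (3) $T$ is injective. (4) $T(\langle \{u \in \mathcal{B} \mid u \leq v\} \rangle) = \langle \{u \in \mathcal{B} \mid u \leq v\} \rangle$ for all $v \in \mathcal{B}$. (5) $\pi_vT\pi_v \neq 0$ for all $v \in \mathcal{B}$. Moreover, if $T$ is invertible, then its inverse is triangular with respect to $(\mathcal{B}, \leq)$.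
   Context: $V$ has arbitrary dimension. $\mathrm{End}_k(V)$ is the $k$-algebra of all linear transformations of $V$, and $\langle X\rangle$ is the subspace generated by $X$. Given a basis $\mathcal{B}$ for $V$ and a partial order $\leq$ on $\mathcal{B}$, $T \in \mathrm{End}_k(V)$ is triangular with respect to $(\mathcal{B}, \leq)$ if $T(v) \in \langle \{u \in \mathcal{B} \mid u \leq v\} \rangle$ for all $v \in \mathcal{B}$. A subspace $W \subseteq V$ is $T$-invariant if $T(W) \subseteq W$; in (2) the restriction is regarded as an element of $\mathrm{End}_k(W)$. *)

theory Defs
  imports "HOL.Vector_Spaces" "HOL-Library.FuncSet"
begin

context vector_space
begin

definition is_basis :: "'b set \<Rightarrow> bool"
  where "is_basis B \<longleftrightarrow> independent B \<and> span B = UNIV"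

definition lower_span :: "'b set \<Rightarrow> 'b rel \<Rightarrow> 'b \<Rightarrow> 'b set"
  where "lower_span B r v = span {u \<in> B. (u, v) \<in> r}"

definition triangular :: "'b set \<Rightarrow> 'b rel \<Rightarrow> ('b \<Rightarrow> 'b) \<Rightarrow> bool"
  where "triangular B r T \<longleftrightarrow> (\<forall>v\<in>B. T v \<in> lower_span B r v)"

definition fin_dim_subspace :: "'b set \<Rightarrow> bool"
  where "fin_dim_subspace W \<longleftrightarrow> subspace W \<and> (\<exists>C. finite C \<and> independent C \<and> span C = W)"

text \<open>Elements of \<open>endos W\<close> are extensional, so that each endomorphism of a subspace \<open>W\<close> is
  represented by exactly one function on the ambient type; \<open>restrict T W\<close> is the restriction of
  \<open>T\<close> as such an element.\<close>

definition endos :: "'b set \<Rightarrow> ('b \<Rightarrow> 'b) set"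
  where "endos W = {f \<in> W \<rightarrow>\<^sub>E W.
    (\<forall>x\<in>W. \<forall>y\<in>W. f (x + y) = f x + f y) \<and> (\<forall>c. \<forall>x\<in>W. f (c *s x) = c *s f x)}"

definition inverse_in_endos :: "'b set \<Rightarrow> ('b \<Rightarrow> 'b) \<Rightarrow> ('b \<Rightarrow> 'b) \<Rightarrow> bool"
  where "inverse_in_endos W f g \<longleftrightarrow> f \<in> endos W \<and> g \<in> endos W \<and>
    compose W g f = (\<lambda>x\<in>W. x) \<and> compose W f g = (\<lambda>x\<in>W. x)"

definition invertible_in_endos :: "'b set \<Rightarrow> ('b \<Rightarrow> 'b) \<Rightarrow> bool"
  where "invertible_in_endos W f \<longleftrightarrow> (\<exists>g. inverse_in_endos W f g)"

lemma endos_UNIV: "f \<in> endos UNIV \<longleftrightarrow> Vector_Spaces.linear scale scale f"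
  by (auto simp: endos_def Vector_Spaces.linear_iff vector_space_axioms)

lemma inverse_in_endos_UNIV:
  "inverse_in_endos UNIV f g \<longleftrightarrow>
    Vector_Spaces.linear scale scale f \<and> Vector_Spaces.linear scale scale g \<and> g \<circ> f = id \<and> f \<circ> g = id"
  by (auto simp: inverse_in_endos_def endos_UNIV compose_def fun_eq_iff)

definition is_projection :: "'b set \<Rightarrow> 'b set \<Rightarrow> ('b \<Rightarrow> 'b) \<Rightarrow> bool"
  where "is_projection U K p \<longleftrightarrow> Vector_Spaces.linear scale scale p \<and> p \<circ> p = p \<and>
    range p = U \<and> {x. p x = 0} = K"

lemma is_projection_basis_exists:
  assumes "is_basis B" "v \<in> B"
  shows "is_projection (span {v}) (span (B - {v})) (\<lambda>x. representation B x v *s v)"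
proof -
  have ind: "independent B" and sp: "span B = UNIV" and vs: "\<And>x. x \<in> span B"
    using assms by (auto simp: is_basis_def)
  have v0: "v \<noteq> 0" using ind assms(2) dependent_zero by blast
  have rv: "representation B v v = 1"
    using representation_basis[OF ind assms(2)] by simp
  have lin: "Vector_Spaces.linear scale scale (\<lambda>x. representation B x v *s v)"
    by (simp add: Vector_Spaces.linear_iff vector_space_axioms representation_add[OF ind vs vs]
        representation_scale[OF ind vs] scale_left_distrib)
  have idem: "(\<lambda>x. representation B x v *s v) \<circ> (\<lambda>x. representation B x v *s v)
      = (\<lambda>x. representation B x v *s v)"
    by (auto simp: representation_scale[OF ind vs] rv)
  have rng: "range (\<lambda>x. representation B x v *s v) = span {v}"
  proof -
    have "k *s v \<in> range (\<lambda>x. representation B x v *s v)" for k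
      by (rule range_eqI[of _ _ "k *s v"]) (simp add: representation_scale[OF ind vs] rv)
    thus ?thesis by (auto simp: span_singleton)
  qed
  have ker: "(representation B x v = 0) \<longleftrightarrow> x \<in> span (B - {v})" for x
  proof
    assume "representation B x v = 0"
    then have "(\<Sum>b | representation B x b \<noteq> 0. representation B x b *s b) \<in> span (B - {v})"
      by (intro span_sum span_scale span_base) (auto dest: representation_ne_zero)
    then show "x \<in> span (B - {v})"
      using sum_nonzero_representation_eq[OF ind vs] by simp
  next
    assume x: "x \<in> span (B - {v})"
    have "representation B x = representation (B - {v}) x"
      by (rule representation_extend[OF ind x]) auto
    then show "representation B x v = 0"
      using representation_ne_zero[of "B - {v}" x v] by auto
  qed
  show ?thesis
    using lin idem rng ker v0 by (auto simp: is_projection_def)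
qed

lemma is_projection_unique:
  assumes p: "is_projection U K p" and q: "is_projection U K q"
  shows "p = q"
proof
  fix x
  interpret p: Vector_Spaces.linear scale scale p using p by (simp add: is_projection_def)
  interpret q: Vector_Spaces.linear scale scale q using q by (simp add: is_projection_def)
  have pp: "p (p y) = p y" and qq: "q (q y) = q y" for y
    using p q by (metis is_projection_def comp_apply)+
  have "p x \<in> range q" using p q by (auto simp: is_projection_def)
  then have "q (p x) = p x" using qq by auto
  moreover have "p (x - p x) = 0" by (simp add: p.diff pp)
  then have "q (x - p x) = 0" using p q by (auto simp: is_projection_def)
  ultimately show "p x = q x" by (simp add: q.diff)
qed

end

end

theory Submission
  imports Defs
begin

text \<open>
  By well-founded induction, every \<open>v \<in> B\<close> lies in the span of a finite set of basis vectors
  \<open>\<le> v\<close> whose span is \<open>T\<close>-invariant. An injective \<open>T\<close> is therefore onto on each of these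
  finite-dimensional pieces, which gives (4) and surjectivity. Conversely, (4) forces a nonzero
  diagonal, since otherwise \<open>v\<close> would lie in the span of the basis vectors \<open>< v\<close>; and a nonzero
  diagonal makes \<open>T\<close> injective by looking at the largest basis vector in the support of a vector.
  (2) gives (3) because the line through a vector of the kernel is invariant.
\<close>

text \<open>Supplies the leading basis vector of a nonzero vector: its support is finite and
  nonempty. When a new element is not below the old maximum, totality makes it the new one.\<close>

lemma finite_has_greatest_in_linear_order:
  assumes "linear_order_on B r" "finite F" "F \<noteq> {}" "F \<subseteq> B"
  shows "\<exists>v\<in>F. \<forall>u\<in>F. (u, v) \<in> r"
  using assms(2-)
proof (induction rule: finite_ne_induct)
  case (singleton x)
  then show ?case
    using assms(1) by (auto simp: order_on_defs refl_on_def)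
next
  case (insert x F)
  then obtain v where v: "v \<in> F" "\<forall>u\<in>F. (u, v) \<in> r"
    by auto
  have refl: "\<forall>u\<in>B. (u, u) \<in> r" and trans: "trans r" and total: "total_on B r"
    using assms(1) by (auto simp: order_on_defs refl_on_def)
  show ?case
  proof (cases "(x, v) \<in> r")
    case True
    then show ?thesis
      using v by auto
  next
    case False
    then have "(v, x) \<in> r"
      using total refl v insert.prems by (metis insert_subset subsetD total_on_def)
    then show ?thesis
      using v trans refl insert.prems by (intro bexI[of _ x]) (auto dest: transD)
  qed
qed

section \<open>Linear algebra on spans and invertibility on subspaces\<close>

context vector_space
begin

lemma image_span_eq_if_inj:
  assumes f: "Vector_Spaces.linear scale scale f" and inj: "inj_on f (span C)"
    and C: "finite C" "independent C" and sub: "f ` C \<subseteq> span C"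
  shows "f ` span C = span C"
proof -
  interpret f: Vector_Spaces.linear scale scale f by (rule f)
  have indep: "independent (f ` C)"
    using f.independent_injective_image[OF C(2) inj] .
  have card: "card (f ` C) = card C"
    using inj_on_subset[OF inj span_superset] by (rule card_image)
  have "C \<subseteq> span (f ` C)"
  proof (rule ccontr)
    assume "\<not> C \<subseteq> span (f ` C)"
    then obtain v where v: "v \<in> C" "v \<notin> span (f ` C)"
      by auto
    then have "independent (insert v (f ` C))"
      using indep by (simp add: independent_insert)
    moreover have "insert v (f ` C) \<subseteq> span C"
      using v(1) sub by (simp add: span_base)
    ultimately have "card (insert v (f ` C)) \<le> card C"
      using independent_span_bound[OF C(1)] by blast
    moreover have "v \<notin> f ` C"
      using v(2) span_base by blast
    ultimately show False
      using C(1) card by simp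
  qed
  then have "span C \<subseteq> span (f ` C)"
    by (rule span_minimal) simp
  moreover have "span (f ` C) \<subseteq> span C"
    using sub by (rule span_minimal) simp
  ultimately show ?thesis
    by (simp add: f.span_image)
qed

text \<open>The set-theoretic inverse of a linear bijection is automatically linear. This lets later
  arguments deal with bijectivity of \<open>f\<close> itself instead of extensional
  functions.\<close>

lemma invertible_in_endos_iff_bij_betw:
  assumes f: "Vector_Spaces.linear scale scale f" and W: "subspace W"
  shows "invertible_in_endos W (restrict f W) \<longleftrightarrow> bij_betw f W W"
proof
  assume "invertible_in_endos W (restrict f W)"
  then obtain g where "restrict f W \<in> W \<rightarrow>\<^sub>E W" "g \<in> W \<rightarrow>\<^sub>E W"
    and gf: "compose W g (restrict f W) = (\<lambda>x\<in>W. x)"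
    and fg: "compose W (restrict f W) g = (\<lambda>x\<in>W. x)"
    unfolding invertible_in_endos_def inverse_in_endos_def endos_def
    by blast
  then have fW: "f ` W \<subseteq> W" and gW: "g ` W \<subseteq> W"
    by (auto simp: PiE_iff)
  have "g (f x) = x" if "x \<in> W" for x
    using fun_cong[OF gf, of x] that by (simp add: compose_def)
  moreover have "f (g x) = x" if "x \<in> W" for x
    using fun_cong[OF fg, of x] that gW by (auto simp: compose_def)
  ultimately show "bij_betw f W W"
    using fW gW by (intro bij_betw_byWitness[where f' = g]) auto
next
  interpret f: Vector_Spaces.linear scale scale f by (rule f)
  assume bij: "bij_betw f W W"
  \<comment> \<open>Restricting the inverse makes it extensional, as membership in
    \<open>endos W\<close> demands.\<close>
  define g where "g = restrict (inv_into W f) W"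
  have fW: "f x \<in> W" if "x \<in> W" for x
    using bij that by (auto simp: bij_betw_def)
  have gW: "g x \<in> W" and fg: "f (g x) = x" if "x \<in> W" for x
    using bij that by (auto simp: g_def bij_betw_def inv_into_into f_inv_into_f)
  have gf: "g (f x) = x" if "x \<in> W" for x
    using bij that fW by (auto simp: g_def bij_betw_def)
  \<comment> \<open>\<open>f\<close> sends \<open>g x + g y\<close> to \<open>x + y\<close>, so
    applying \<open>g\<close> to that image gives additivity; scaling is handled the same
    way.\<close>
  have "g (x + y) = g x + g y" if "x \<in> W" "y \<in> W" for x y
    using gf[of "g x + g y"] that W fg gW by (simp add: f.add subspace_add)
  moreover have "g (c *s x) = c *s g x" if "x \<in> W" for c x
    using gf[of "c *s g x"] that W fg gW by (simp add: f.scale subspace_scale)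
  ultimately have "g \<in> endos W"
    using gW by (auto simp: endos_def g_def)
  moreover have "restrict f W \<in> endos W"
    using fW W by (auto simp: endos_def f.add f.scale subspace_add subspace_scale)
  moreover have "compose W g (restrict f W) = (\<lambda>x\<in>W. x)"
    using gf by (intro ext) (simp add: compose_def restrict_def)
  moreover have "compose W (restrict f W) g = (\<lambda>x\<in>W. x)"
    using gW fg by (intro ext) (simp add: compose_def restrict_def)
  ultimately have "inverse_in_endos W (restrict f W) g"
    by (simp add: inverse_in_endos_def)
  then show "invertible_in_endos W (restrict f W)"
    by (auto simp: invertible_in_endos_def)
qed

end

section \<open>Triangular endomorphisms and invariance of lower spans\<close>

locale triangular_endomorphism = vector_space scale
  for scale :: "'k::field \<Rightarrow> 'v::ab_group_add \<Rightarrow> 'v" (infixr "*s" 75) +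
  fixes T :: "'v \<Rightarrow> 'v" and B :: "'v set" and r :: "'v rel"
  assumes linear_T: "Vector_Spaces.linear scale scale T"
    and basis: "is_basis B"
    and well_order: "well_order_on B r"
    and triangular: "triangular B r T"
begin

sublocale T: Vector_Spaces.linear scale scale T
  by (rule linear_T)

lemma independent_basis: "independent B" and span_basis: "x \<in> span B"
  using basis by (auto simp: is_basis_def)

lemma order_refl: "v \<in> B \<Longrightarrow> (v, v) \<in> r"
  and order_trans: "(u, v) \<in> r \<Longrightarrow> (v, w) \<in> r \<Longrightarrow> (u, w) \<in> r"
  and order_antisym: "(u, v) \<in> r \<Longrightarrow> (v, u) \<in> r \<Longrightarrow> u = v"
  and order_in_basis: "(u, v) \<in> r \<Longrightarrow> u \<in> B"
proof -
  have "refl_on B r" "trans r" "antisym r" "r \<subseteq> B \<times> B"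
    using well_order by (auto simp: order_on_defs)
  then show "v \<in> B \<Longrightarrow> (v, v) \<in> r" "(u, v) \<in> r \<Longrightarrow> (v, w) \<in> r \<Longrightarrow> (u, w) \<in> r"
    "(u, v) \<in> r \<Longrightarrow> (v, u) \<in> r \<Longrightarrow> u = v" "(u, v) \<in> r \<Longrightarrow> u \<in> B"
    by (blast dest: refl_onD transD antisymD)+
qed

lemma lower_span_mono: "(u, v) \<in> r \<Longrightarrow> lower_span B r u \<subseteq> lower_span B r v"
  unfolding lower_span_def by (intro span_mono) (auto intro: order_trans)

lemma T_basis_in_lower_span: "v \<in> B \<Longrightarrow> T v \<in> lower_span B r v"
  using triangular by (simp add: triangular_def)

lemma T_lower_span_subset: "T ` lower_span B r v \<subseteq> lower_span B r v"
proof -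
  have "T u \<in> lower_span B r v" if "(u, v) \<in> r" for u
    using T_basis_in_lower_span[of u] lower_span_mono[OF that] order_in_basis[OF that] by auto
  then have "span (T ` {u \<in> B. (u, v) \<in> r}) \<subseteq> lower_span B r v"
    unfolding lower_span_def by (intro span_minimal) auto
  then show ?thesis
    by (simp add: lower_span_def T.span_image)
qed

section \<open>Finite invariant pieces and surjectivity\<close>

lemma finite_invariant_basis_subset:
  assumes "v \<in> B"
  shows "\<exists>C. finite C \<and> C \<subseteq> {u \<in> B. (u, v) \<in> r} \<and> v \<in> C \<and> T ` C \<subseteq> span C"
proof -
  have "wf (r - Id)"
    using well_order by (simp add: well_order_on_def)
  then show ?thesis
    using assms
  proof (induction v)
    case (less v)
    from T_basis_in_lower_span[OF \<open>v \<in> B\<close>]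
    obtain F c where F: "finite F" "F \<subseteq> {u \<in> B. (u, v) \<in> r}" and "T v = (\<Sum>u\<in>F. c u *s u)"
      unfolding lower_span_def span_explicit by blast
    then have "T v \<in> span F"
      by (auto intro: span_sum span_scale span_base)
    \<comment> \<open>\<open>F\<close> may contain \<open>v\<close>, where the induction hypothesis
      says nothing. So \<open>v\<close> is removed before the choice and put back by hand in
      \<open>D\<close>, which then still contains \<open>F\<close>.\<close>
    have "\<forall>u\<in>F - {v}. \<exists>C. finite C \<and> C \<subseteq> {w \<in> B. (w, u) \<in> r} \<and> u \<in> C \<and> T ` C \<subseteq> span C"
      using less.IH F(2) by auto
    from bchoice[OF this] obtain C where C: "\<And>u. u \<in> F - {v} \<Longrightarrow>
        finite (C u) \<and> C u \<subseteq> {w \<in> B. (w, u) \<in> r} \<and> u \<in> C u \<and> T ` C u \<subseteq> span (C u)"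
      by auto
    define D where "D = insert v (\<Union>u\<in>F - {v}. C u)"
    have "finite D" "v \<in> D"
      using F(1) C by (auto simp: D_def)
    moreover have "D \<subseteq> {u \<in> B. (u, v) \<in> r}"
      using C F(2) \<open>v \<in> B\<close> order_refl order_trans unfolding D_def by blast
    moreover have "T ` D \<subseteq> span D"
    proof -
      have "F \<subseteq> D"
        using C by (auto simp: D_def)
      then have "T v \<in> span D"
        using \<open>T v \<in> span F\<close> span_mono by blast
      moreover have "T ` C u \<subseteq> span D" if "u \<in> F - {v}" for u
        using C[OF that] that span_mono[of "C u" D] by (auto simp: D_def)
      ultimately show ?thesis
        by (auto simp: D_def)
    qed
    ultimately show ?case
      by blast
  qed
qed

text \<open>A lower span may be infinite-dimensional, but each basis vector in it lies in a finite
  invariant span that \<open>T\<close> maps onto itself. The image is a subspace, so reaching the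
  generators suffices.\<close>

lemma lower_span_image_eq_if_inj:
  assumes "inj T"
  shows "T ` lower_span B r v = lower_span B r v"
proof
  show "T ` lower_span B r v \<subseteq> lower_span B r v"
    by (rule T_lower_span_subset)
  have "u \<in> T ` lower_span B r v" if "u \<in> B" "(u, v) \<in> r" for u
  proof -
    obtain C where C: "finite C" "C \<subseteq> {w \<in> B. (w, u) \<in> r}" "u \<in> C" "T ` C \<subseteq> span C"
      using finite_invariant_basis_subset[OF \<open>u \<in> B\<close>] by blast
    have "independent C"
      using C(2) independent_basis independent_mono by blast
    then have "T ` span C = span C"
      using C assms by (intro image_span_eq_if_inj[OF linear_T]) (auto intro: inj_on_subset)
    moreover have "u \<in> span C"
      using C(3) by (rule span_base)
    moreover have "span C \<subseteq> lower_span B r u"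
      unfolding lower_span_def using C(2) by (rule span_mono)
    ultimately show ?thesis
      using lower_span_mono[OF that(2)] by blast
  qed
  moreover have "subspace (T ` lower_span B r v)"
    unfolding lower_span_def by (intro T.subspace_image subspace_span)
  ultimately show "lower_span B r v \<subseteq> T ` lower_span B r v"
    by (subst lower_span_def, intro span_minimal) auto
qed

text \<open>Every basis vector lies in its own lower span, which an injective \<open>T\<close> maps
  onto itself; hence the range contains a basis.\<close>

lemma bij_T_iff_inj: "bij T \<longleftrightarrow> inj T"
proof
  assume inj: "inj T"
  have "v \<in> range T" if "v \<in> B" for v
  proof -
    have "v \<in> lower_span B r v"
      using that order_refl by (auto simp: lower_span_def intro: span_base)
    then show ?thesis
      using lower_span_image_eq_if_inj[OF inj, of v] by blast
  qed
  then have "span B \<subseteq> range T"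
    by (intro span_minimal T.subspace_image subspace_UNIV) auto
  then show "bij T"
    using inj span_basis by (auto intro!: bijI)
qed (rule bij_is_inj)

section \<open>Diagonal coefficients\<close>

lemma T_strict_lower_span:
  "T ` span {u \<in> B. (u, v) \<in> r \<and> u \<noteq> v} \<subseteq> span {u \<in> B. (u, v) \<in> r \<and> u \<noteq> v}"
    (is "_ ` ?S \<subseteq> ?S")
proof -
  have "T u \<in> ?S" if "u \<in> B" "(u, v) \<in> r" "u \<noteq> v" for u
  proof -
    \<comment> \<open>Antisymmetry keeps \<open>v\<close> out of the vectors below \<open>u\<close>,
      since \<open>u\<close> is strictly below \<open>v\<close>.\<close>
    have "lower_span B r u \<subseteq> ?S"
      unfolding lower_span_def
      using that by (intro span_mono) (auto intro: order_trans dest: order_antisym)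
    then show ?thesis
      using T_basis_in_lower_span[OF that(1)] by blast
  qed
  then have "span (T ` {u \<in> B. (u, v) \<in> r \<and> u \<noteq> v}) \<subseteq> ?S"
    by (intro span_minimal) auto
  then show ?thesis
    by (simp add: T.span_image)
qed

text \<open>Coordinates over \<open>B\<close> and over \<open>C\<close> agree on
  \<open>span C\<close>, and the latter vanish outside \<open>C\<close>.\<close>

lemma representation_eq_0_if_in_span_Diff:
  assumes "x \<in> span C" "C \<subseteq> B - {v}"
  shows "representation B x v = 0"
proof -
  have "representation B x = representation C x"
    using assms by (intro representation_extend independent_basis) auto
  then show ?thesis
    using assms(2) representation_ne_zero[of C x v] by auto
qed

text \<open>With a zero diagonal coefficient, \<open>T\<close> would push the whole lower span of
  \<open>v\<close> into the strict one, which does not contain \<open>v\<close>.\<close>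

lemma diagonal_nonzero_if_lower_span_image_eq:
  assumes v: "v \<in> B" and eq: "T ` lower_span B r v = lower_span B r v"
  shows "representation B (T v) v \<noteq> 0"
proof
  assume 0: "representation B (T v) v = 0"
  let ?A = "{u \<in> B. (u, v) \<in> r \<and> u \<noteq> v}"
  have lower: "{u \<in> B. (u, v) \<in> r} = insert v ?A"
    using v order_refl by auto
  have "T v \<in> span (insert v ?A)"
    using T_basis_in_lower_span[OF v] by (simp add: lower_span_def lower)
  \<comment> \<open>\<open>k\<close> turns out to be the diagonal coefficient: subtracting
    \<open>k *s v\<close> from \<open>T v\<close> leaves a vector without
    \<open>v\<close>-coordinate.\<close>
  then obtain k where k: "T v - k *s v \<in> span ?A"
    by (auto simp: span_insert)
  have "representation B (T v - k *s v) v = 0"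
    by (rule representation_eq_0_if_in_span_Diff[OF k]) auto
  then have "k = 0"
    using 0 v by (simp add: representation_diff representation_scale representation_basis
        independent_basis span_basis)
  then have "T v \<in> span ?A"
    using k by simp
  then have "T ` insert v ?A \<subseteq> span ?A"
    using T_strict_lower_span[of v] span_superset[of ?A] by auto
  then have "T ` lower_span B r v \<subseteq> span ?A"
    using span_minimal[of "T ` insert v ?A" "span ?A"]
    by (simp add: lower_span_def lower T.span_image[symmetric] del: image_insert)
  moreover have "v \<in> lower_span B r v"
    using lower by (auto simp: lower_span_def intro: span_base)
  ultimately have "v \<in> span ?A"
    using eq by auto
  then have "representation B v v = 0"
    by (rule representation_eq_0_if_in_span_Diff) auto
  then show False
    using v by (simp add: representation_basis independent_basis)
qed

text \<open>A leading-term argument: if \<open>v\<close> is the largest basis vector in the support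
  of \<open>x\<close>, the \<open>v\<close>-coordinate of \<open>T x\<close> is that of
  \<open>x\<close> times the diagonal coefficient at \<open>v\<close>, hence nonzero.\<close>

lemma inj_if_diagonal_nonzero:
  assumes diag: "\<And>v. v \<in> B \<Longrightarrow> representation B (T v) v \<noteq> 0"
  shows "inj T"
proof -
  have "x = 0" if Tx: "T x = 0" for x
  proof (rule ccontr)
    assume "x \<noteq> 0"
    define F where "F = {b. representation B x b \<noteq> 0}"
    have F: "finite F" "F \<subseteq> B"
      by (auto simp: F_def finite_representation dest: representation_ne_zero)
    have sum: "(\<Sum>b\<in>F. representation B x b *s b) = x"
      unfolding F_def by (rule sum_nonzero_representation_eq[OF independent_basis span_basis])
    then have "F \<noteq> {}"
      using \<open>x \<noteq> 0\<close> by auto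
    then obtain v where v: "v \<in> F" "\<forall>u\<in>F. (u, v) \<in> r"
      using finite_has_greatest_in_linear_order[of B r F] F well_order
      by (auto simp: well_order_on_def)
    let ?A = "{u \<in> B. (u, v) \<in> r \<and> u \<noteq> v}"
    define y where "y = (\<Sum>b\<in>F - {v}. representation B x b *s b)"
    have x: "x = representation B x v *s v + y"
      using sum F(1) v(1) by (simp add: y_def sum.remove)
    \<comment> \<open>The rest of the support is strictly below \<open>v\<close>, and
      \<open>T\<close> preserves the strict lower span, so \<open>T y\<close> contributes nothing at
      \<open>v\<close>.\<close>
    have "y \<in> span ?A"
      unfolding y_def using v F by (intro span_sum span_scale span_base) auto
    then have "representation B (T y) v = 0"
      using T_strict_lower_span[of v]
      by (intro representation_eq_0_if_in_span_Diff[of _ ?A]) auto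
    moreover have "T x = representation B x v *s T v + T y"
      by (subst x) (simp add: T.add T.scale)
    ultimately have "representation B x v * representation B (T v) v = 0"
      using Tx by (metis representation_add representation_scale representation_zero
          independent_basis span_basis add.right_neutral)
    then show False
      using diag[of v] v(1) F by (auto simp: F_def)
  qed
  then show ?thesis
    by (simp add: T.inj_iff_eq_0)
qed

text \<open>Range and kernel determine a projection, so \<open>p\<close> extracts the
  \<open>v\<close>-component. The sandwich therefore scales that component by the diagonal
  coefficient.\<close>

lemma projection_sandwich_nonzero_iff:
  assumes v: "v \<in> B" and p: "is_projection (span {v}) (span (B - {v})) p"
  shows "p \<circ> T \<circ> p \<noteq> (\<lambda>x. 0) \<longleftrightarrow> representation B (T v) v \<noteq> 0"
proof -
  have p_eq: "p = (\<lambda>x. representation B x v *s v)"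
    using is_projection_unique[OF p is_projection_basis_exists[OF basis v]] .
  have comp: "(p \<circ> T \<circ> p) x = (representation B x v * representation B (T v) v) *s v" for x
    by (simp add: p_eq T.scale representation_scale independent_basis span_basis)
  have "v \<noteq> 0"
    using v independent_basis dependent_zero by blast
  moreover have "representation B v v = 1"
    using v by (simp add: representation_basis independent_basis)
  ultimately show ?thesis
    \<comment> \<open>Evaluating at \<open>v\<close> detects the coefficient, because
      \<open>v\<close> is nonzero and has \<open>v\<close>-coordinate 1.\<close>
    unfolding fun_eq_iff comp by (metis mult_zero_right mult_1 scale_eq_0_iff)
qed

section \<open>Assembling the equivalences, and the inverse\<close>

lemma inj_iff_invertible_on_finite_dimensional_invariant:
  "inj T \<longleftrightarrow> (\<forall>W. fin_dim_subspace W \<and> T ` W \<subseteq> W \<longrightarrow> invertible_in_endos W (restrict T W))"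
proof (intro iffI allI impI)
  fix W
  assume inj: "inj T" and W: "fin_dim_subspace W \<and> T ` W \<subseteq> W"
  then obtain C where C: "finite C" "independent C" "W = span C"
    by (auto simp: fin_dim_subspace_def)
  have "T ` C \<subseteq> span C"
    using W C(3) span_superset by blast
  then have "T ` W = W"
    using image_span_eq_if_inj[OF linear_T _ C(1,2)] inj C(3) by (auto intro: inj_on_subset)
  then have "bij_betw T W W"
    using inj by (auto simp: bij_betw_def intro: inj_on_subset)
  then show "invertible_in_endos W (restrict T W)"
    using W by (simp add: invertible_in_endos_iff_bij_betw linear_T fin_dim_subspace_def)
next
  assume inv: "\<forall>W. fin_dim_subspace W \<and> T ` W \<subseteq> W \<longrightarrow> invertible_in_endos W (restrict T W)"
  have "x = 0" if Tx: "T x = 0" for x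
  proof (rule ccontr)
    assume "x \<noteq> 0"
    then have "fin_dim_subspace (span {x})"
      unfolding fin_dim_subspace_def by (intro conjI exI[of _ "{x}"]) auto
    moreover have "T ` span {x} \<subseteq> span {x}"
      using Tx by (auto simp: span_singleton T.scale)
    ultimately have "bij_betw T (span {x}) (span {x})"
      using inv invertible_in_endos_iff_bij_betw[OF linear_T subspace_span] by blast
    \<comment> \<open>\<open>x\<close> and \<open>0\<close> are distinct points of the line with the
      same image.\<close>
    then show False
      using Tx \<open>x \<noteq> 0\<close> span_base[of x "{x}"] span_zero[of "{x}"]
      by (auto simp: bij_betw_def inj_on_def)
  qed
  then show "inj T"
    by (simp add: T.inj_iff_eq_0)
qed

lemma inj_iff_lower_span_image_eq:
  "inj T \<longleftrightarrow> (\<forall>v\<in>B. T ` lower_span B r v = lower_span B r v)"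
proof
  assume "inj T"
  then show "\<forall>v\<in>B. T ` lower_span B r v = lower_span B r v"
    by (simp add: lower_span_image_eq_if_inj)
next
  assume "\<forall>v\<in>B. T ` lower_span B r v = lower_span B r v"
  then show "inj T"
    by (intro inj_if_diagonal_nonzero diagonal_nonzero_if_lower_span_image_eq) auto
qed

lemma inj_iff_diagonal_nonzero: "inj T \<longleftrightarrow> (\<forall>v\<in>B. representation B (T v) v \<noteq> 0)"
proof
  assume "inj T"
  then show "\<forall>v\<in>B. representation B (T v) v \<noteq> 0"
    by (simp add: lower_span_image_eq_if_inj diagonal_nonzero_if_lower_span_image_eq)
next
  assume "\<forall>v\<in>B. representation B (T v) v \<noteq> 0"
  then show "inj T"
    by (intro inj_if_diagonal_nonzero) auto
qed

lemma invertible_iff_inj: "invertible_in_endos UNIV T \<longleftrightarrow> inj T"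
  using invertible_in_endos_iff_bij_betw[OF linear_T subspace_UNIV]
  by (simp add: bij_T_iff_inj restrict_UNIV)

text \<open>\<open>T\<close> maps the lower span of \<open>v\<close> onto itself, so
  \<open>v\<close> is the image of some vector in it, and \<open>S\<close> returns that
  vector.\<close>

lemma triangular_inverse:
  assumes "inverse_in_endos UNIV T S"
  shows "triangular B r S"
  unfolding triangular_def
proof
  fix v
  assume "v \<in> B"
  have "inj T"
    using assms invertible_iff_inj by (auto simp: invertible_in_endos_def)
  have ST: "S (T x) = x" for x
    using assms by (auto simp: inverse_in_endos_UNIV fun_eq_iff)
  have "v \<in> T ` lower_span B r v"
    unfolding lower_span_image_eq_if_inj[OF \<open>inj T\<close>]
    using \<open>v \<in> B\<close> order_refl by (auto simp: lower_span_def intro: span_base)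
  then show "S v \<in> lower_span B r v"
    using ST by auto
qed

end

theorem proposition16:
  fixes scale :: "'k::field \<Rightarrow> 'v::ab_group_add \<Rightarrow> 'v"
    and T :: "'v \<Rightarrow> 'v" and B :: "'v set" and r :: "'v rel" and \<pi> :: "'v \<Rightarrow> 'v \<Rightarrow> 'v"
  assumes "vector_space scale"
    and "Vector_Spaces.linear scale scale T"
    and "vector_space.is_basis scale B"
    and "well_order_on B r"
    and "vector_space.triangular scale B r T"
    and "\<forall>v\<in>B. vector_space.is_projection scale
           (module.span scale {v}) (module.span scale (B - {v})) (\<pi> v)"
  shows "(vector_space.invertible_in_endos scale UNIV T \<longleftrightarrow>
      (\<forall>W. vector_space.fin_dim_subspace scale W \<and> T ` W \<subseteq> W
         \<longrightarrow> vector_space.invertible_in_endos scale W (restrict T W))) \<and>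
    (vector_space.invertible_in_endos scale UNIV T \<longleftrightarrow> inj T) \<and>
    (vector_space.invertible_in_endos scale UNIV T \<longleftrightarrow>
      (\<forall>v\<in>B. T ` vector_space.lower_span scale B r v = vector_space.lower_span scale B r v)) \<and>
    (vector_space.invertible_in_endos scale UNIV T \<longleftrightarrow>
      (\<forall>v\<in>B. \<pi> v \<circ> T \<circ> \<pi> v \<noteq> (\<lambda>x. 0))) \<and>
    (\<forall>S. vector_space.inverse_in_endos scale UNIV T S
         \<longrightarrow> vector_space.triangular scale B r S)"
proof -
  interpret triangular_endomorphism scale T B r
    using assms by (simp add: triangular_endomorphism_def triangular_endomorphism_axioms_def)
  have "(\<forall>v\<in>B. \<pi> v \<circ> T \<circ> \<pi> v \<noteq> (\<lambda>x. 0)) \<longleftrightarrow> inj T"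
    using assms(6) projection_sandwich_nonzero_iff inj_iff_diagonal_nonzero by auto
  then show ?thesis
    using invertible_iff_inj inj_iff_invertible_on_finite_dimensional_invariant
      inj_iff_lower_span_image_eq triangular_inverse by simp
qed

end
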